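(* Assume that there exists a weight $2$ modular form $\chi\in M_2$ which is invertible in $R$, and let $u=x\chi$. Let $q\in B_0^{\Gamma}$ and let $(a_k)_{k\ge0}$ be the sequence of elements of $R^{\Gamma}$ such that $q=\sum_{k\ge0}a_ku^k$. Then the modular forms $f_{2m}\in M_{2m}$ appearing as the terms of $\Psi_2^{-1}(q)=\sum_{m\ge0}f_{2m}$ are given by $f_0=a_0$ and, for $m\ge1$, $$f_{2m}=(-1)^m\frac{(m-1)!}{(2m-2)!}\sum_{k=0}^m\ \sum_{n=\max(k,1)}^{m}(-1)^{n}\frac{(2n-1)!\,(m-n)!}{(n-1)!\,(m+n-1)}\binom{m}{m-n}\,[a_k,g_{k,2n}]_{m-n}.$$
   Context: $\Gamma$ is a subgroup of $\mathrm{SL}(2,\mathbb{C})$ and $R$ is a commutative $\mathbb{C}$-algebra of functions in one variable $z$, which is a domain, such that: (i) $\Gamma$ acts on the right on $R$ by automorphisms $(f\cdot\gamma)(z)=f\left(\frac{az+b}{cz+d}\right)$ for $\gamma=\begin{pmatrix}a&b\\c&d\end{pmatrix}$; (ii) the function $z\mapsto cz+d$ is an invertible element of $R$ for every $\gamma\in\Gamma$; (iii) $R$ is stable under $\partial_z=\frac{d}{dz}$, which is nonzero on $R$. Put $d_z=-\partial_z$, $f^{(n)}=\partial_z^nf$. For $k\in\mathbb{Z}$, $M_k=\{f\in R: f\left(\frac{az+b}{cz+d}\right)=(cz+d)^kf(z)\ \forall\gamma\in\Gamma\}$; $R^\Gamma=M_0$. It is assumed that $M_k\cap M_\ell=\{0\}$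 for $k\ne\ell$; elements of $\prod_j M_{2j}$ are written as formal sums of their components. $B=R(\!(x;d_z)\!)$ is the ring of Laurent series $\sum_{i\ge m}f_ix^i$ with coefficients in $R$ and $xf=\sum_{n\ge0}d_z^n(f)x^{n+1}$; $B_0$ is its subring of power series in $x$. $\Gamma$ acts on $B$ by automorphisms extending the action on $R$ with $(x^{-1}|\gamma)=(cz+d)^2x^{-1}$; $B_0^\Gamma$ is the subring of invariant elements of $B_0$. Every element of $B_0^\Gamma$ is uniquely a series $\sum_{k\ge0}a_ku^k$ with $a_k\in R^\Gamma$. $\Psi_2:\prod_{j\ge0}M_{2j}\to B_0^\Gamma$ is the vector space isomorphism $\sum_jf_{2j}\mapsto\sum_j\psi_{2j}(f_{2j})$, where $\psi_0(f)=f$ and, for $j\ge1$, $$\psi_{2j}(f)=\sum_{n\ge0}\frac{(2j-1)!\,(n+j-1)!}{(n+2j-1)!\,(j-1)!}\binom{-j-1}{n}f^{(n)}x^{j+n}.$$ For $k\ge0$, the modular forms $g_{k,2n}\in M_{2n}$ are defined by $\Psi_2^{-1}(u^k)=\sum_{n\ge k}g_{k,2n}$. For $f\in M_k$, $g\in M_\ell$, the $n$-th Rankin-Cohen bracket is $[f,g]_n=\sum_{j=0}^n(-1)^j\binom{k+n-1}{n-j}\binom{\ell+n-1}{j}f^{(j)}g^{(n-j)}\in M_{k+\ell+2n}$; in $[a_k,g_{k,2n}]_{m-n}$ the weights are $0$ and $2n$. *)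

theory Defs
  imports "HOL-Complex_Analysis.Complex_Analysis" "HOL-Algebra.Group"
begin

unbundle fps_syntax

section \<open>Homographies\<close>

definition SL2C :: "(complex^2^2) monoid" where
  "SL2C = \<lparr>carrier = {A. det A = 1}, mult = (**), one = mat 1\<rparr>"

definition denom :: "complex^2^2 \<Rightarrow> complex \<Rightarrow> complex" where
  "denom A z = A $ 2 $ 1 * z + A $ 2 $ 2"

definition homography :: "complex^2^2 \<Rightarrow> complex \<Rightarrow> complex" where
  "homography A z = (A $ 1 $ 1 * z + A $ 1 $ 2) / denom A z"

section \<open>Integer powers of units\<close>

definition unit_inv :: "'r::comm_ring_1 \<Rightarrow> 'r" where
  "unit_inv a = (THE b. a * b = 1)"

definition unit_powi :: "'r::comm_ring_1 \<Rightarrow> int \<Rightarrow> 'r" where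
  "unit_powi a k = (if k \<ge> 0 then a ^ nat k else unit_inv a ^ nat (- k))"

section \<open>Algebras of functions and modular forms\<close>

text \<open>
  Below, \<open>J \<gamma>\<close> is the element \<open>z \<mapsto> c z + d\<close> of the algebra and \<open>act \<gamma> f\<close> is \<open>f \<cdot> \<gamma>\<close>.
\<close>

definition modular_forms ::
  "(complex^2^2) set \<Rightarrow> (complex^2^2 \<Rightarrow> 'r \<Rightarrow> 'r) \<Rightarrow> (complex^2^2 \<Rightarrow> 'r) \<Rightarrow> int \<Rightarrow> 'r::comm_ring_1 set" where
  "modular_forms \<Gamma> act J k = {f. \<forall>\<gamma>\<in>\<Gamma>. act \<gamma> f = unit_powi (J \<gamma>) k * f}"

text \<open>
  The domain \<open>R\<close> is the type \<open>'r\<close>, and \<open>ev f\<close> is the function of \<open>z\<close> that the element \<open>f\<close> is.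
  Functions may have poles, so that for instance the rational functions are covered (with
  \<open>\<Omega> = \<complex>\<close>) as well as the holomorphic or the meromorphic functions on the upper half plane;
  accordingly, functions are compared off a discrete closed subset of \<open>\<Omega>\<close>. Since \<open>ev\<close> is injective
  in this sense, \<open>cst\<close>, \<open>D\<close>, \<open>act\<close> and \<open>J\<close> are determined by \<open>ev\<close>, and their existence says that
  \<open>R\<close> contains the constants, is stable under \<open>d/dz\<close> and under \<open>\<Gamma>\<close>, and contains the functions
  \<open>z \<mapsto> c z + d\<close>.
\<close>

locale modular_function_algebra =
  fixes \<Omega> :: "complex set"
    and \<Gamma> :: "(complex^2^2) set"
    and ev :: "'r::idom \<Rightarrow> complex \<Rightarrow> complex"
    and cst :: "complex \<Rightarrow> 'r"
    and D :: "'r \<Rightarrow> 'r"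
    and act :: "complex^2^2 \<Rightarrow> 'r \<Rightarrow> 'r"
    and J :: "complex^2^2 \<Rightarrow> 'r"
  assumes open_domain: "open \<Omega>"
    and subgroup_SL2C: "subgroup \<Gamma> SL2C"
    and domain_stable: "\<lbrakk>\<gamma> \<in> \<Gamma>; z \<in> \<Omega>; denom \<gamma> z \<noteq> 0\<rbrakk> \<Longrightarrow> homography \<gamma> z \<in> \<Omega>"
    and ev_meromorphic: "ev f meromorphic_on \<Omega>"
    and ev_inject: "(\<forall>\<^sub>\<approx>z\<in>\<Omega>. ev f z = ev g z) \<Longrightarrow> f = g"
    and ev_add: "\<forall>\<^sub>\<approx>z\<in>\<Omega>. ev (f + g) z = ev f z + ev g z"
    and ev_mult: "\<forall>\<^sub>\<approx>z\<in>\<Omega>. ev (f * g) z = ev f z * ev g z"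
    and ev_cst: "\<forall>\<^sub>\<approx>z\<in>\<Omega>. ev (cst c) z = c"
    and ev_act: "\<gamma> \<in> \<Gamma> \<Longrightarrow> \<forall>\<^sub>\<approx>z\<in>\<Omega>. ev (act \<gamma> f) z = ev f (homography \<gamma> z)"
    and ev_J: "\<gamma> \<in> \<Gamma> \<Longrightarrow> \<forall>\<^sub>\<approx>z\<in>\<Omega>. ev (J \<gamma>) z = denom \<gamma> z"
    and J_unit: "\<gamma> \<in> \<Gamma> \<Longrightarrow> J \<gamma> dvd 1"
    and ev_D: "\<forall>\<^sub>\<approx>z\<in>\<Omega>. ev (D f) z = deriv (ev f) z"
    and D_nonzero: "\<exists>f. D f \<noteq> 0"
    and weights_disjoint:
      "k \<noteq> l \<Longrightarrow> modular_forms \<Gamma> act J k \<inter> modular_forms \<Gamma> act J l = {0}"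

section \<open>Formal pseudodifferential operators\<close>

text \<open>
  The elements of \<open>B = R((x; d))\<close> with \<open>d = - D\<close> are represented by Laurent series, with
  coefficients on the left of the powers of \<open>x = fls_X\<close>. The commutative product that the library
  defines on this type is not the product of \<open>B\<close>. The latter comes from
  \<open>x f = (\<Sum>n. d\<^sup>n(f) x\<^sup>n\<^sup>+\<^sup>1)\<close>, equivalently \<open>x\<^sup>-\<^sup>1 f = f x\<^sup>-\<^sup>1 - d(f)\<close>, which give
  \<open>x\<^sup>i f = (\<Sum>n. (i+n-1 choose n) d\<^sup>n(f) x\<^sup>i\<^sup>+\<^sup>n)\<close> for all integers \<open>i\<close>.
\<close>

definition skew_times :: "(complex \<Rightarrow> 'r::comm_ring_1) \<Rightarrow> ('r \<Rightarrow> 'r) \<Rightarrow> 'r fls \<Rightarrow> 'r fls \<Rightarrow> 'r fls" where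
  "skew_times cst D p q = Abs_fls (\<lambda>m.
     \<Sum>i = fls_subdegree p..m - fls_subdegree q. \<Sum>k = fls_subdegree q..m - i.
       p $$ i * cst (of_int (m - k - 1) gchoose nat (m - i - k))
         * ((\<lambda>f. - D f) ^^ nat (m - i - k)) (q $$ k))"

lemma skew_times_nth:
  "skew_times cst D p q $$ m =
     (\<Sum>i = fls_subdegree p..m - fls_subdegree q. \<Sum>k = fls_subdegree q..m - i.
       p $$ i * cst (of_int (m - k - 1) gchoose nat (m - i - k))
         * ((\<lambda>f. - D f) ^^ nat (m - i - k)) (q $$ k))"
  unfolding skew_times_def
  by (rule nth_Abs_fls_lower_bound[of "fls_subdegree p + fls_subdegree q"]) auto

lemma skew_times_X_const:
  assumes "D 0 = 0" and "cst 1 = 1"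
  shows "skew_times cst D fls_X (fls_const f) $$ (int n + 1) = ((\<lambda>f. - D f) ^^ n) f"
proof -
  have D0: "((\<lambda>f. - D f) ^^ k) 0 = 0" for k
    by (induction k) (simp_all add: assms)
  have bin: "(of_nat n :: complex) gchoose n = 1"
    using binomial_gbinomial[of n n, where 'a = complex] by simp
  have summand: "fls_X $$ i * cst (of_int (int n + 1 - k - 1) gchoose nat (int n + 1 - i - k))
         * ((\<lambda>f. - D f) ^^ nat (int n + 1 - i - k)) (fls_const f $$ k)
       = (if i = 1 then if k = 0 then ((\<lambda>f. - D f) ^^ n) f else 0 else 0)" for i k
    using bin by (simp add: D0 assms)
  have inner: "(\<Sum>k = 0..int n + 1 - i. if i = 1 then if k = 0 then c else 0 else 0)
      = (if i = 1 then c else 0)" for i :: int and c :: 'a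
    by auto
  show ?thesis
    unfolding skew_times_nth summand by (simp add: inner)
qed

fun skew_power :: "(complex \<Rightarrow> 'r::comm_ring_1) \<Rightarrow> ('r \<Rightarrow> 'r) \<Rightarrow> 'r fls \<Rightarrow> nat \<Rightarrow> 'r fls" where
  "skew_power cst D p 0 = 1"
| "skew_power cst D p (Suc n) = skew_times cst D p (skew_power cst D p n)"

text \<open>
  The image of \<open>x\<^sup>i\<close> under \<open>\<gamma>\<close>. As \<open>x\<^sup>-\<^sup>1 | \<gamma> = (c z + d)\<^sup>2 x\<^sup>-\<^sup>1\<close>, we have
  \<open>x | \<gamma> = x (c z + d)\<^sup>-\<^sup>2\<close>. The image of \<open>x\<^sup>i\<close> has lowest exponent \<open>i\<close>, so that the sums in
  \<open>fls_act\<close> are finite.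
\<close>

definition X_act ::
  "(complex \<Rightarrow> 'r::comm_ring_1) \<Rightarrow> ('r \<Rightarrow> 'r) \<Rightarrow> (complex^2^2 \<Rightarrow> 'r) \<Rightarrow>
   complex^2^2 \<Rightarrow> int \<Rightarrow> 'r fls" where
  "X_act cst D J \<gamma> i =
     (if i \<ge> 0 then skew_power cst D (skew_times cst D fls_X (fls_const (unit_powi (J \<gamma>) (-2)))) (nat i)
      else skew_power cst D (skew_times cst D (fls_const (J \<gamma> ^ 2)) fls_X_inv) (nat (- i)))"

definition fls_act ::
  "(complex \<Rightarrow> 'r::comm_ring_1) \<Rightarrow> ('r \<Rightarrow> 'r) \<Rightarrow> (complex^2^2 \<Rightarrow> 'r \<Rightarrow> 'r) \<Rightarrow>
   (complex^2^2 \<Rightarrow> 'r) \<Rightarrow> complex^2^2 \<Rightarrow> 'r fls \<Rightarrow> 'r fls" where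
  "fls_act cst D act J \<gamma> p =
     Abs_fls (\<lambda>m. \<Sum>i = fls_subdegree p..m. act \<gamma> (p $$ i) * X_act cst D J \<gamma> i $$ m)"

definition power_series :: "'r::zero fls set" where
  "power_series = {p. \<forall>i<0. p $$ i = 0}"

definition invariant_series ::
  "(complex^2^2) set \<Rightarrow> (complex \<Rightarrow> 'r::comm_ring_1) \<Rightarrow> ('r \<Rightarrow> 'r) \<Rightarrow> (complex^2^2 \<Rightarrow> 'r \<Rightarrow> 'r) \<Rightarrow>
   (complex^2^2 \<Rightarrow> 'r) \<Rightarrow> 'r fls set" where
  "invariant_series \<Gamma> cst D act J = {p \<in> power_series. \<forall>\<gamma>\<in>\<Gamma>. fls_act cst D act J \<gamma> p = p}"

text \<open>
  The infinite sum of a sequence \<open>p\<close> of power series such that \<open>p k\<close> is divisible by \<open>x\<^sup>k\<close>: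
  only the terms with \<open>k \<le> N\<close> contribute to the coefficient of \<open>x\<^sup>N\<close>.
\<close>

definition formal_sum :: "(nat \<Rightarrow> 'r::comm_monoid_add fls) \<Rightarrow> 'r fls" where
  "formal_sum p = fps_to_fls (Abs_fps (\<lambda>N. \<Sum>k\<le>N. p k $$ int N))"

section \<open>The lifting and the Rankin--Cohen brackets\<close>

text \<open>\<open>psi cst D j\<close> is \<open>\<psi>\<^sub>2\<^sub>j\<close>, and the component of weight \<open>2j\<close> of \<open>f\<close> is \<open>f j\<close>.\<close>

definition psi :: "(complex \<Rightarrow> 'r::comm_ring_1) \<Rightarrow> ('r \<Rightarrow> 'r) \<Rightarrow> nat \<Rightarrow> 'r \<Rightarrow> 'r fls" where
  "psi cst D j f =
     (if j = 0 then fls_const f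
      else fls_shift (- int j) (fps_to_fls (Abs_fps (\<lambda>n.
        cst (fact (2 * j - 1) * fact (n + j - 1) / (fact (n + 2 * j - 1) * fact (j - 1))
             * ((- of_nat j - 1) gchoose n)) * (D ^^ n) f))))"

definition Psi2 :: "(complex \<Rightarrow> 'r::comm_ring_1) \<Rightarrow> ('r \<Rightarrow> 'r) \<Rightarrow> (nat \<Rightarrow> 'r) \<Rightarrow> 'r fls" where
  "Psi2 cst D f = formal_sum (\<lambda>j. psi cst D j (f j))"

definition rankin_cohen ::
  "(complex \<Rightarrow> 'r::comm_ring_1) \<Rightarrow> ('r \<Rightarrow> 'r) \<Rightarrow> int \<Rightarrow> int \<Rightarrow> nat \<Rightarrow> 'r \<Rightarrow> 'r \<Rightarrow> 'r" where
  "rankin_cohen cst D k l n f g =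
     (\<Sum>j\<le>n. cst ((-1) ^ j * (of_int (k + int n - 1) gchoose (n - j))
                  * (of_int (l + int n - 1) gchoose j)) * (D ^^ j) f * (D ^^ (n - j)) g)"

end

theory Submission
  imports Defs
begin

text \<open>
  The theorem rests on an identity in an arbitrary ring with a derivation \<open>D\<close>: for \<open>n \<ge> 1\<close>,
  multiplying the lift of \<open>g\<close> in weight \<open>2n\<close> by \<open>a\<close> on the left gives
  \<open>a \<psi>\<^sub>2\<^sub>n(g) = (\<Sum>m\<ge>n. \<psi>\<^sub>2\<^sub>m(c\<^sub>m\<^sub>n [a, g]\<^bsub>m-n\<^esub>))\<close>, with the constants \<open>c\<^sub>m\<^sub>n\<close> of the theorem and with \<open>a\<close>
  counted with weight \<open>0\<close> (\<open>mult_psi_nth\<close>). As \<open>u\<^sup>k\<close> is the sum of the lifts of its components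
  \<open>g\<^bsub>k,2n\<^esub>\<close>, this rewrites \<open>q = (\<Sum>k. a\<^sub>k u\<^sup>k)\<close> as a sum of lifts. The coefficient of \<open>x\<^sup>m\<close> in
  \<open>\<psi>\<^sub>2\<^sub>m(f)\<close> is \<open>f\<close> and the lower ones vanish, so the components of a sum of lifts can be read off one
  after the other (\<open>Psi2_nth_determines\<close>), which gives the formula for \<open>f\<^sub>2\<^sub>m\<close>. The case \<open>n = 0\<close> stands
  apart: by the same uniqueness, only \<open>u\<^sup>0 = 1\<close> has a component of weight \<open>0\<close>, and \<open>a\<^sub>0 \<cdot> 1\<close> is the lift
  of \<open>a\<^sub>0\<close>.

  To compare coefficients in the identity, everything is written in terms of the total derivatives
  \<open>D\<^sup>L\<^sup>-\<^sup>i(D\<^sup>i(a) g)\<close>, \<open>i \<le> L\<close>. In this system \<open>a D\<^sup>L(g)\<close> has binomial coefficients with alternating signs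
  (\<open>inverse_Leibniz\<close>), and a Rankin--Cohen bracket has a product of two binomial coefficients, by
  Vandermonde's convolution (\<open>rankin_cohen_total_derivatives\<close>); a further derivative of the bracket
  has the same coefficients. What remains is, for each \<open>i\<close>, a hypergeometric summation over \<open>m\<close>, whose
  summands have the very well-poised factor \<open>2m - 1\<close>; it is proved by creative telescoping
  (\<open>well_poised_sum\<close>).
\<close>

section \<open>A very well-poised hypergeometric sum\<close>

text \<open>
  Multiplying by \<open>(l + 1) (A + l + 1)\<close> should turn the sum for \<open>l + 1\<close> into the sum for \<open>l\<close>. The
  difference of the two summands is the forward difference in \<open>r\<close> of a hypergeometric term \<open>- G\<close>
  (a Wilf--Zeilberger pair), so that all but the boundary terms cancel.
\<close>

lemma well_poised_sum:
  fixes A p l :: nat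
  shows "(\<Sum>r\<le>l. of_nat (A + p + 1 + 2 * r) * fact (A + p + r) * fact (p + r)
             / (fact (A + p + 1 + l + r) * fact (l - r) * fact (A + r) * fact r))
         = (fact p / (fact l * fact (A + l)) :: 'a::field_char_0)"
proof (induction l)
  case 0
  have "fact (A + p + 1) = (of_nat (A + p + 1) * fact (A + p) :: 'a)"
    by simp
  moreover have "(of_nat (A + p + 1) :: 'a) \<noteq> 0"
    unfolding of_nat_eq_0_iff by simp
  ultimately show ?case
    by (simp del: of_nat_add of_nat_Suc fact_Suc add_Suc_right)
next
  case (Suc l)
  define t where "t l r = (of_nat (A + p + 1 + 2 * r) * fact (A + p + r) * fact (p + r)
             / (fact (A + p + 1 + l + r) * fact (l - r) * fact (A + r) * fact r) :: 'a)" for l r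
  define c where "c = (of_nat ((l + 1) * (A + l + 1)) :: 'a)"
  define G where "G K = (fact (A + p + K) * fact (p + K) * of_nat K * of_nat (A + K)
      / (fact (A + p + 1 + l + K) * fact (l + 1 - K) * fact (A + K) * fact K) :: 'a)" for K
  have c: "c \<noteq> 0"
    unfolding c_def of_nat_eq_0_iff by simp
  have partial: "(\<Sum>r<K. c * t (Suc l) r - t l r) = - G K" if "K \<le> Suc l" for K
    using that
  proof (induction K)
    case 0
    show ?case by (simp add: G_def)
  next
    case (Suc K)
    then obtain d where l: "l = K + d"
      using le_Suc_ex by auto
    define X where "X = (fact (A + p + K) :: 'a)"
    define Y where "Y = (fact (p + K) :: 'a)"
    define Z where "Z = (fact (A + p + 1 + l + K) :: 'a)"
    define W where "W = (fact d :: 'a)"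
    define U where "U = (fact (A + K) :: 'a)"
    define V where "V = (fact K :: 'a)"
    have nz: "Z \<noteq> 0" "W \<noteq> 0" "U \<noteq> 0" "V \<noteq> 0"
      unfolding Z_def W_def U_def V_def by (rule fact_nonzero)+
    define z where "z = (of_nat (A + p + 2 + l + K) :: 'a)"
    define e where "e = (of_nat (d + 1) :: 'a)"
    have nz': "z \<noteq> 0" "e \<noteq> 0"
      unfolding z_def e_def of_nat_eq_0_iff by simp_all
    define b where "b = (of_nat (A + K + 1) :: 'a)"
    define k where "k = (of_nat (K + 1) :: 'a)"
    have nz'': "b \<noteq> 0" "k \<noteq> 0"
      unfolding b_def k_def of_nat_eq_0_iff by simp_all
    have G1: "G (Suc K) = (of_nat (A + p + K + 1) * X * (of_nat (p + K + 1) * Y) * k * b)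
                / (z * Z * W * (b * U) * (k * V))"
      by (simp add: G_def X_def Y_def Z_def W_def U_def V_def l z_def b_def k_def add_ac del: of_nat_add)
    have G0: "G K = (X * Y * of_nat K * of_nat (A + K)) / (Z * (e * W) * U * V)"
      by (simp add: G_def X_def Y_def Z_def W_def U_def V_def l e_def  add_ac Suc_diff_le del: of_nat_add)
    have t1: "t (Suc l) K = of_nat (A + p + 1 + 2 * K) * X * Y / (z * Z * (e * W) * U * V)"
      by (simp add: t_def X_def Y_def Z_def W_def U_def V_def l z_def e_def add_ac Suc_diff_le del: of_nat_add)
    have t0: "t l K = of_nat (A + p + 1 + 2 * K) * X * Y / (Z * W * U * V)"
      by (simp add: t_def X_def Y_def Z_def W_def U_def V_def l add_ac del: of_nat_add)
    \<comment> \<open>After removal of the common factor, a polynomial identity is left.\<close>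
    have "c * t (Suc l) K - t l K = (c * of_nat (A + p + 1 + 2 * K) - of_nat (A + p + 1 + 2 * K) * z * e) * (X * Y / (z * Z * (e * W) * U * V))"
      unfolding t1 t0 using nz nz' by (simp add: divide_simps) (simp add: algebra_simps)
    also have "c * of_nat (A + p + 1 + 2 * K) - of_nat (A + p + 1 + 2 * K) * z * e
        = of_nat K * of_nat (A + K) * z - of_nat (A + p + K + 1) * of_nat (p + K + 1) * e"
      by (simp add: c_def z_def e_def l algebra_simps)
    also have "(of_nat K * of_nat (A + K) * z - of_nat (A + p + K + 1) * of_nat (p + K + 1) * e) * (X * Y / (z * Z * (e * W) * U * V))
       = G K - G (Suc K)"
      unfolding G1 G0 using nz nz' nz'' by (simp add: divide_simps) (simp add: algebra_simps)
    finally show ?case using Suc by simp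
  qed
  have last: "c * t (Suc l) (Suc l) = G (Suc l)"
  proof -
    have "A + p + 1 + Suc l + Suc l = Suc (A + p + 1 + l + Suc l)" "A + p + 1 + 2 * Suc l = Suc (A + p + 1 + l + Suc l)"
      by simp_all
    hence "fact (A + p + 1 + Suc l + Suc l) = (of_nat (A + p + 1 + 2 * Suc l) * fact (A + p + 1 + l + Suc l) :: 'a)"
      by (simp only: fact_Suc)
    moreover have "(of_nat (A + p + 1 + 2 * Suc l) :: 'a) \<noteq> 0"
      unfolding of_nat_eq_0_iff by simp
    ultimately have "t (Suc l) (Suc l) = fact (A + p + Suc l) * fact (p + Suc l)
        / (fact (A + p + 1 + l + Suc l) * fact (A + Suc l) * fact (Suc l))"
      unfolding t_def diff_self_eq_0 fact_0 mult_1_right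
      by (metis (no_types, opaque_lifting) mult.assoc mult_divide_mult_cancel_left)
    moreover have "c = of_nat (Suc l) * of_nat (A + Suc l)"
      by (simp add: c_def algebra_simps)
    ultimately show ?thesis
      by (simp add: G_def mult_ac del: of_nat_add of_nat_Suc fact_Suc add_Suc_right)
  qed
  have "c * (\<Sum>r\<le>Suc l. t (Suc l) r) - (\<Sum>r\<le>l. t l r)
      = (\<Sum>r<Suc l. c * t (Suc l) r - t l r) + c * t (Suc l) (Suc l)"
    by (simp add: sum_subtractf sum_distrib_left lessThan_Suc_atMost distrib_left)
  also have "\<dots> = 0"
    using partial[of "Suc l"] last by simp
  finally have "c * (\<Sum>r\<le>Suc l. t (Suc l) r) = (\<Sum>r\<le>l. t l r)"
    by simp
  also have "\<dots> = fact p / (fact l * fact (A + l))"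
    using Suc.IH by (simp add: t_def)
  also have "\<dots> = c * (fact p / (fact (Suc l) * fact (A + Suc l)))"
  proof -
    have "fact (Suc l) * fact (A + Suc l) = c * (fact l * fact (A + l))"
      by (simp add: c_def algebra_simps)
    thus ?thesis using c by (simp del: fact_Suc add_Suc_right)
  qed
  finally have "(\<Sum>r\<le>Suc l. t (Suc l) r) = fact p / (fact (Suc l) * fact (A + Suc l))"
    using c mult_cancel_left by blast
  thus ?case unfolding t_def .
qed

text \<open>
  The sum over \<open>m\<close> that decides the coefficient of \<open>D\<^sup>L\<^sup>-\<^sup>i(D\<^sup>i(a) g)\<close>, with \<open>N = m - n\<close> and \<open>v = 2n - 1\<close>.
  For \<open>i = 0\<close> the binomial coefficient of \<open>N - 1\<close> over \<open>N\<close> leaves only \<open>N = 0\<close>; note that \<open>N - 1\<close> is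
  \<open>-1\<close> there. For \<open>i \<ge> 1\<close>, putting \<open>r = N - i\<close> and writing the binomial coefficients with factorials
  turns it into \<open>well_poised_sum\<close>.
\<close>

lemma bracket_coefficient_sum:
  fixes v i L :: nat
  assumes "v \<ge> 1" and "i \<le> L"
  shows "(\<Sum>N=i..L. of_nat (v + 2 * N) / (fact (v + L + N) * fact (L - N) * of_nat (v + N))
             * ((of_int (int N - 1) gchoose (N - i)) * (of_int (int v + int N + int i - 1) gchoose i)))
         = (of_nat (L choose i) / (fact (v + L) * fact L) :: 'a::field_char_0)"
proof (cases i)
  case 0
  have zero: "(of_int (int N - 1) :: 'a) gchoose N = 0" if N: "N \<noteq> 0" for N
  proof -
    obtain n where "N = Suc n"
      using N by (cases N) auto
    hence "(of_int (int N - 1) :: 'a) gchoose N = of_nat n gchoose Suc n"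
      by simp
    also have "\<dots> = of_nat (n choose Suc n)"
      by (simp only: binomial_gbinomial)
    finally show ?thesis
      by (simp add: binomial_eq_0)
  qed
  show ?thesis
    using \<open>v \<ge> 1\<close> unfolding 0
    by (subst sum.remove[of _ 0]) (simp_all add: zero del: of_nat_add of_int_diff)
next
  case (Suc p)
  define A where "A = v + p + 1"
  obtain l where L: "L = Suc p + l"
    using \<open>i \<le> L\<close> Suc le_Suc_ex by blast
  have summand: "of_nat (v + 2 * N) / (fact (v + L + N) * fact (L - N) * of_nat (v + N))
             * ((of_int (int N - 1) gchoose (N - i)) * (of_int (int v + int N + int i - 1) gchoose i))
      = of_nat (A + p + 1 + 2 * r) * fact (A + p + r) * fact (p + r)
             / (fact (A + p + 1 + l + r) * fact (l - r) * fact (A + r) * fact r) * (1 / (fact p * fact (Suc p)) :: 'a)"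
    if N: "N = r + Suc p" and "r \<le> l" for N r
  proof -
    have "(of_int (int N - 1) :: 'a) gchoose (N - i) = of_nat ((p + r) choose r)"
      by (simp add: N Suc binomial_gbinomial add.commute)
    hence 1: "(of_int (int N - 1) :: 'a) gchoose (N - i) = fact (p + r) / (fact r * fact p)"
      using binomial_fact[of r "p + r", where 'a = 'a] by simp
    have "(of_int (int v + int N + int i - 1) :: 'a) = of_nat (A + p + r)"
      by (simp add: N Suc A_def)
    hence "(of_int (int v + int N + int i - 1) :: 'a) gchoose i = of_nat ((A + p + r) choose Suc p)"
      by (simp only: Suc binomial_gbinomial)
    also have "\<dots> = fact (A + p + r) / (fact (Suc p) * fact (v + p + r))"
      using binomial_fact[of "Suc p" "A + p + r", where 'a = 'a] by (simp add: A_def add_ac del: fact_Suc)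
    finally have 2: "(of_int (int v + int N + int i - 1) :: 'a) gchoose i
         = fact (A + p + r) / (fact (Suc p) * fact (v + p + r))" .
    have 3: "fact (A + r) = (of_nat (v + N) * fact (v + p + r) :: 'a)"
      using fact_Suc[of "v + p + r", where 'a = 'a] by (simp add: A_def N add_ac del: fact_Suc)
    have 4: "v + 2 * N = A + p + 1 + 2 * r" "v + L + N = A + p + 1 + l + r" "L - N = l - r"
      using N L by (auto simp: A_def)
    show ?thesis
      unfolding 1 2 3 4 by (simp add: mult_ac del: of_nat_add of_nat_mult fact_Suc of_nat_Suc add_Suc_right)
  qed
  have "(\<Sum>N=i..L. of_nat (v + 2 * N) / (fact (v + L + N) * fact (L - N) * of_nat (v + N))
             * ((of_int (int N - 1) gchoose (N - i)) * (of_int (int v + int N + int i - 1) gchoose i)))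
      = (\<Sum>r\<le>l. of_nat (A + p + 1 + 2 * r) * fact (A + p + r) * fact (p + r)
             / (fact (A + p + 1 + l + r) * fact (l - r) * fact (A + r) * fact r) * (1 / (fact p * fact (Suc p)) :: 'a))"
  proof -
    have shift: "sum F {i..L} = (\<Sum>r\<le>l. F (r + Suc p))" for F :: "nat \<Rightarrow> 'a"
      by (rule sum.reindex_bij_witness[of _ "\<lambda>r. r + Suc p" "\<lambda>N. N - Suc p"]) (auto simp: L Suc)
    show ?thesis
      unfolding shift by (intro sum.cong[OF refl summand[OF refl]]) simp
  qed
  also have "\<dots> = (fact p / (fact l * fact (A + l))) * (1 / (fact p * fact (Suc p)))"
    by (simp only: sum_distrib_right[symmetric] well_poised_sum)
  also have "\<dots> = of_nat (L choose i) / (fact (v + L) * fact L)"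
  proof -
    have "of_nat (L choose i) = (fact L / (fact (Suc p) * fact l) :: 'a)"
      using binomial_fact[of i L, where 'a = 'a] by (simp add: L Suc del: fact_Suc)
    moreover have "A + l = v + L"
      by (simp add: A_def L)
    ultimately show ?thesis
      by (simp del: fact_Suc)
  qed
  finally show ?thesis .
qed

section \<open>Rankin--Cohen brackets and total derivatives\<close>

locale differential_algebra =
  fixes cst :: "complex \<Rightarrow> 'r::comm_ring_1" and D :: "'r \<Rightarrow> 'r"
  assumes cst_1 [simp]: "cst 1 = 1"
    and cst_add: "cst (a + b) = cst a + cst b"
    and cst_mult: "cst (a * b) = cst a * cst b"
    and D_add: "D (f + g) = D f + D g"
    and D_mult: "D (f * g) = f * D g + D f * g"
    and D_cst [simp]: "D (cst c) = 0"
begin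

lemma cst_0 [simp]: "cst 0 = 0"
  using cst_add[of 0 0] by simp

lemma cst_sum: "cst (sum h A) = (\<Sum>x\<in>A. cst (h x))"
  by (induction A rule: infinite_finite_induct) (simp_all add: cst_add)

lemma D_0 [simp]: "D 0 = 0"
  using D_add[of 0 0] by simp

lemma Dpow_0 [simp]: "(D ^^ n) 0 = 0"
  by (induction n) simp_all

lemma Dpow_add: "(D ^^ n) (f + g) = (D ^^ n) f + (D ^^ n) g"
  by (induction n) (simp_all add: D_add)

lemma Dpow_sum: "(D ^^ n) (sum h A) = (\<Sum>x\<in>A. (D ^^ n) (h x))"
  by (induction A rule: infinite_finite_induct) (simp_all add: Dpow_add)

lemma Dpow_cst_mult: "(D ^^ n) (cst c * f) = cst c * (D ^^ n) f"
  by (induction n) (simp_all add: D_mult)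

text \<open>
  Moving derivatives from \<open>g\<close> to \<open>a\<close> by repeated integration by parts,
  \<open>D\<^sup>s(a) D(g) = D(D\<^sup>s(a) g) - D\<^sup>s\<^sup>+\<^sup>1(a) g\<close>; the two terms combine by Pascal's rule.
\<close>

lemma inverse_Leibniz:
  "a * (D ^^ n) g = (\<Sum>s\<le>n. cst ((-1) ^ s * of_nat (n choose s)) * (D ^^ (n - s)) ((D ^^ s) a * g))"
proof (induction n arbitrary: g)
  case 0
  show ?case by simp
next
  case (Suc n)
  define E where "E s = (D ^^ (Suc n - s)) ((D ^^ s) a * g)" for s
  define c where "c n s = cst ((-1) ^ s * of_nat (n choose s))" for n s
  have parts: "(D ^^ (n - s)) ((D ^^ s) a * D g) = E s - E (Suc s)" if "s \<le> n" for s
  proof -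
    have "D ((D ^^ s) a * g) = (D ^^ s) a * D g + (D ^^ Suc s) a * g"
      by (simp add: D_mult)
    hence "(D ^^ (n - s)) (D ((D ^^ s) a * g)) = (D ^^ (n - s)) ((D ^^ s) a * D g) + E (Suc s)"
      by (simp add: Dpow_add E_def)
    moreover have "(D ^^ (n - s)) (D ((D ^^ s) a * g)) = E s"
      using that by (simp add: E_def Suc_diff_le funpow_swap1)
    ultimately show ?thesis by simp
  qed
  have "a * (D ^^ Suc n) g = a * (D ^^ n) (D g)"
    by (simp add: funpow_swap1)
  also have "\<dots> = (\<Sum>s\<le>n. c n s * (D ^^ (n - s)) ((D ^^ s) a * D g))"
    unfolding c_def by (rule Suc.IH)
  also have "\<dots> = (\<Sum>s\<le>n. c n s * E s) - (\<Sum>s\<le>n. c n s * E (Suc s))"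
    by (simp add: parts sum_subtractf right_diff_distrib)
  also have "(\<Sum>s\<le>n. c n s * E s) = c n 0 * E 0 + (\<Sum>s\<le>n. c n (Suc s) * E (Suc s))"
  proof -
    have "(\<Sum>s\<le>n. c n s * E s) = (\<Sum>s\<le>Suc n. c n s * E s)"
      by (simp add: c_def binomial_eq_0)
    thus ?thesis by (simp only: sum.atMost_Suc_shift)
  qed
  also have "c n 0 * E 0 + (\<Sum>s\<le>n. c n (Suc s) * E (Suc s)) - (\<Sum>s\<le>n. c n s * E (Suc s))
      = c n 0 * E 0 + (\<Sum>s\<le>n. (c n (Suc s) - c n s) * E (Suc s))"
    by (simp add: sum_subtractf left_diff_distrib)
  also have "\<dots> = c (Suc n) 0 * E 0 + (\<Sum>s\<le>n. c (Suc n) (Suc s) * E (Suc s))"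
  proof -
    have "c n (Suc s) - c n s = c (Suc n) (Suc s)" for s
    proof -
      have "(-1) ^ Suc s * of_nat (n choose Suc s)
          = (-1) ^ Suc s * of_nat (Suc n choose Suc s) + ((-1) ^ s * of_nat (n choose s) :: complex)"
        by (simp add: algebra_simps)
      thus ?thesis
        by (simp add: c_def cst_add del: binomial_Suc_Suc power_Suc)
    qed
    thus ?thesis by (simp add: c_def)
  qed
  also have "\<dots> = (\<Sum>s\<le>Suc n. c (Suc n) s * E s)"
    by (simp only: sum.atMost_Suc_shift)
  finally show ?case by (simp add: c_def E_def)
qed

text \<open>
  Applying \<open>inverse_Leibniz\<close> to each \<open>D\<^sup>j(f) D\<^sup>n\<^sup>-\<^sup>j(g)\<close> contributes a binomial coefficient of \<open>n - j\<close>.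
  Trinomial revision takes the part that depends only on \<open>i\<close> out of the sum over \<open>j\<close>, and
  Vandermonde's convolution evaluates the rest. The advantage over the definition is that \<open>D\<close> acts
  on the right hand side without changing the coefficients.
\<close>

lemma rankin_cohen_total_derivatives:
  "rankin_cohen cst D k l n f g =
     (\<Sum>i\<le>n. cst ((-1) ^ i * (of_int (k + int n - 1) gchoose (n - i))
                  * (of_int (k + l + int n + int i - 2) gchoose i))
             * (D ^^ (n - i)) ((D ^^ i) f * g))"
proof -
  define b where "b j = ((-1) ^ j * (of_int (k + int n - 1) gchoose (n - j))
                  * (of_int (l + int n - 1) gchoose j) :: complex)" for j
  define E where "E i = (D ^^ (n - i)) ((D ^^ i) f * g)" for i
  define e where "e j i = ((-1) ^ (i - j) * of_nat ((n - j) choose (i - j)) :: complex)" for i j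
  have expand: "(D ^^ j) f * (D ^^ (n - j)) g = (\<Sum>i=j..n. cst (e j i) * E i)"
    if "j \<le> n" for j
  proof -
    have "(D ^^ j) f * (D ^^ (n - j)) g
        = (\<Sum>s\<le>n - j. cst ((-1) ^ s * of_nat ((n - j) choose s)) * (D ^^ (n - j - s)) ((D ^^ s) ((D ^^ j) f) * g))"
      by (rule inverse_Leibniz)
    also have "\<dots> = (\<Sum>s\<le>n - j. cst (e j (s + j)) * E (s + j))"
      by (simp add: e_def E_def funpow_add diff_diff_left add.commute)
    also have "\<dots> = (\<Sum>i=j..n. cst (e j i) * E i)"
      using sum.shift_bounds_cl_nat_ivl[of "\<lambda>i. cst (e j i) * E i" 0 j "n - j"] that
      by (simp add: atMost_atLeast0)
    finally show ?thesis .
  qed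
  have coeff: "(\<Sum>j\<le>i. b j * e j i) = (-1) ^ i * (of_int (k + int n - 1) gchoose (n - i))
                  * (of_int (k + l + int n + int i - 2) gchoose i)" if "i \<le> n" for i
  proof -
    have "b j * e j i = (-1) ^ i * (of_int (k + int n - 1) gchoose (n - i))
         * ((of_int (l + int n - 1) gchoose j) * (of_int (k + int i - 1) gchoose (i - j)))"
      if "j \<le> i" for j
    proof -
      have "((of_int (k + int n - 1) :: complex) gchoose (n - j)) * of_nat ((n - j) choose (i - j))
          = (of_int (k + int n - 1) gchoose (n - j)) * (of_nat (n - j) gchoose (n - i))"
        using \<open>i \<le> n\<close> that binomial_symmetric[of "i - j" "n - j"]
        by (simp add: binomial_gbinomial)
      also have "\<dots> = (of_int (k + int n - 1) gchoose (n - i))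
             * ((of_int (k + int n - 1) - of_nat (n - i)) gchoose (n - j - (n - i)))"
        using \<open>i \<le> n\<close> that by (intro gbinomial_trinomial_revision) simp
      also have "(of_int (k + int n - 1) - of_nat (n - i) :: complex) = of_int (k + int i - 1)"
        using \<open>i \<le> n\<close> by (simp add: of_nat_diff)
      also have "n - j - (n - i) = i - j"
        using \<open>i \<le> n\<close> that by simp
      finally have "((of_int (k + int n - 1) :: complex) gchoose (n - j)) * of_nat ((n - j) choose (i - j))
         = (of_int (k + int n - 1) gchoose (n - i)) * (of_int (k + int i - 1) gchoose (i - j))" .
      moreover have "(-1) ^ j * (-1) ^ (i - j) = ((-1) ^ i :: complex)"
        using that by (simp flip: power_add)
      moreover have "b j * e j i = ((-1) ^ j * (-1) ^ (i - j))
         * ((of_int (k + int n - 1) gchoose (n - j)) * of_nat ((n - j) choose (i - j)))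
         * (of_int (l + int n - 1) gchoose j)"
        by (simp only: b_def e_def mult_ac)
      ultimately show ?thesis
        by (simp only: mult_ac)
    qed
    hence "(\<Sum>j\<le>i. b j * e j i) = (-1) ^ i * (of_int (k + int n - 1) gchoose (n - i))
         * (\<Sum>j\<le>i. (of_int (l + int n - 1) gchoose j) * (of_int (k + int i - 1) gchoose (i - j)))"
      by (simp add: sum_distrib_left)
    also have "(\<Sum>j\<le>i. ((of_int (l + int n - 1) :: complex) gchoose j) * (of_int (k + int i - 1) gchoose (i - j)))
        = (of_int (l + int n - 1) + of_int (k + int i - 1)) gchoose i"
      by (simp only: gbinomial_Vandermonde atMost_atLeast0)
    also have "(of_int (l + int n - 1) + of_int (k + int i - 1) :: complex)
         = of_int (k + l + int n + int i - 2)"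
      by simp
    finally show ?thesis .
  qed
  have "rankin_cohen cst D k l n f g = (\<Sum>j\<le>n. cst (b j) * (\<Sum>i=j..n. cst (e j i) * E i))"
    by (simp add: rankin_cohen_def b_def mult.assoc expand)
  also have "\<dots> = (\<Sum>j\<le>n. \<Sum>i=j..n. cst (b j * e j i) * E i)"
    by (simp add: sum_distrib_left cst_mult mult.assoc)
  also have "\<dots> = (\<Sum>i\<le>n. \<Sum>j\<le>i. cst (b j * e j i) * E i)"
    unfolding sum.Sigma[OF finite_atMost ballI[OF finite_atLeastAtMost]] sum.Sigma[OF finite_atMost ballI[OF finite_atMost]]
    by (rule sum.reindex_bij_witness[of _ prod.swap prod.swap]) auto
  also have "\<dots> = (\<Sum>i\<le>n. cst (\<Sum>j\<le>i. b j * e j i) * E i)"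
    by (simp add: cst_sum sum_distrib_right)
  finally show ?thesis
    by (simp add: coeff E_def)
qed

text \<open>
  The inversion of the brackets for the weights \<open>0\<close> and \<open>1 + v\<close>. Both sides are combinations of the
  total derivatives \<open>D\<^sup>L\<^sup>-\<^sup>i(D\<^sup>i(a) g)\<close>, and their coefficients agree by \<open>bracket_coefficient_sum\<close>. The weight
  has to exceed \<open>1\<close> because of the denominator \<open>v + N\<close> at \<open>N = 0\<close>.
\<close>

lemma mult_Dpow_rankin_cohen:
  assumes "v \<ge> 1"
  shows "cst (1 / (fact (v + L) * fact L)) * (a * (D ^^ L) g)
    = (\<Sum>N\<le>L. cst (of_nat (v + 2 * N) / (fact (v + L + N) * fact (L - N) * of_nat (v + N)))
               * (D ^^ (L - N)) (rankin_cohen cst D 0 (1 + int v) N a g))"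
proof -
  define E where "E i = (D ^^ (L - i)) ((D ^^ i) a * g)" for i
  define K where "K N = (of_nat (v + 2 * N) / (fact (v + L + N) * fact (L - N) * of_nat (v + N)) :: complex)" for N
  define p where "p N i = ((of_int (int N - 1) gchoose (N - i)) * (of_int (int v + int N + int i - 1) gchoose i) :: complex)" for N i
  have bracket: "(D ^^ (L - N)) (rankin_cohen cst D 0 (1 + int v) N a g) = (\<Sum>i\<le>N. cst ((-1) ^ i * p N i) * E i)"
    if "N \<le> L" for N
  proof -
    have "0 + (1 + int v) + int N + int i - 2 = int v + int N + int i - 1" for i
      by simp
    hence "rankin_cohen cst D 0 (1 + int v) N a g = (\<Sum>i\<le>N. cst ((-1) ^ i * p N i) * (D ^^ (N - i)) ((D ^^ i) a * g))"
      unfolding rankin_cohen_total_derivatives by (simp only: p_def add_0 mult.assoc)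
    moreover have "(D ^^ (L - N)) ((D ^^ (N - i)) h) = (D ^^ (L - i)) h" if "i \<le> N" for i h
    proof -
      have "L - i = (L - N) + (N - i)"
        using that \<open>N \<le> L\<close> by simp
      thus ?thesis by (simp only: funpow_add o_apply)
    qed
    ultimately show ?thesis
      by (simp add: Dpow_sum Dpow_cst_mult E_def)
  qed
  have "(\<Sum>N\<le>L. cst (K N) * (D ^^ (L - N)) (rankin_cohen cst D 0 (1 + int v) N a g))
      = (\<Sum>N\<le>L. \<Sum>i\<le>N. cst ((-1) ^ i * (K N * p N i)) * E i)"
    by (simp add: bracket sum_distrib_left cst_mult mult_ac)
  also have "\<dots> = (\<Sum>i\<le>L. \<Sum>N=i..L. cst ((-1) ^ i * (K N * p N i)) * E i)"
    unfolding sum.Sigma[OF finite_atMost ballI[OF finite_atLeastAtMost]] sum.Sigma[OF finite_atMost ballI[OF finite_atMost]]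
    by (rule sum.reindex_bij_witness[of _ prod.swap prod.swap]) auto
  also have "\<dots> = (\<Sum>i\<le>L. cst ((-1) ^ i * (\<Sum>N=i..L. K N * p N i)) * E i)"
    by (simp only: cst_sum sum_distrib_right sum_distrib_left)
  also have "\<dots> = (\<Sum>i\<le>L. cst ((-1) ^ i * (of_nat (L choose i) / (fact (v + L) * fact L))) * E i)"
    by (intro sum.cong refl) (simp only: K_def p_def bracket_coefficient_sum[OF assms] atMost_iff)
  also have "\<dots> = cst (1 / (fact (v + L) * fact L)) * (a * (D ^^ L) g)"
  proof -
    have "cst ((-1) ^ i * (of_nat (L choose i) / (fact (v + L) * fact L)))
        = cst (1 / (fact (v + L) * fact L)) * cst ((-1) ^ i * of_nat (L choose i))" for i
      by (simp flip: cst_mult)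
    thus ?thesis
      by (subst inverse_Leibniz) (simp add: E_def sum_distrib_left mult.assoc)
  qed
  finally show ?thesis by (simp add: K_def)
qed

end

section \<open>Multiplying a lifted form by a function\<close>

definition psi_coeff :: "nat \<Rightarrow> nat \<Rightarrow> complex" where
  "psi_coeff j n = fact (2 * j - 1) * fact (n + j - 1) / (fact (n + 2 * j - 1) * fact (j - 1))
             * ((- of_nat j - 1) gchoose n)"

text \<open>
  The constants \<open>c\<^sub>m\<^sub>n\<close> of the introduction, with the part that depends on \<open>m\<close> alone as the first factor, so
  that it can be taken out of a sum over \<open>n\<close>.
\<close>

definition bracket_coeff :: "nat \<Rightarrow> nat \<Rightarrow> complex" where
  "bracket_coeff m n = ((-1) ^ m * (fact (m - 1) / fact (2 * m - 2)))
     * ((-1) ^ n * (fact (2 * n - 1) * fact (m - n) / (fact (n - 1) * of_nat (m + n - 1)))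
                 * of_nat (m choose (m - n)))"

lemma psi_coeff_0 [simp]: "psi_coeff j 0 = 1"
  by (simp add: psi_coeff_def)

lemma psi_coeff_Suc:
  "psi_coeff (Suc j) n = (-1) ^ n * fact (2 * j + 1) * fact (n + j) * fact (n + j + 1)
      / (fact (n + 2 * j + 1) * fact j * fact (j + 1) * fact n)"
proof -
  have "(- of_nat (Suc j) - 1 :: complex) gchoose n = (- of_nat (j + 2)) gchoose n"
    by (rule arg_cong2[where f = "(gchoose)"]) simp_all
  also have "\<dots> = (-1) ^ n * (of_nat (n + j + 1) gchoose n)"
    by (simp only: gbinomial_minus) (simp add: algebra_simps)
  also have "\<dots> = (-1) ^ n * of_nat ((n + j + 1) choose n)"
    by (simp only: binomial_gbinomial)
  also have "of_nat ((n + j + 1) choose n) = (fact (n + j + 1) / (fact n * fact (j + 1)) :: complex)"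
    using binomial_fact[of n "n + j + 1", where 'a = complex] by (simp del: fact_Suc)
  finally have "(- of_nat (Suc j) - 1 :: complex) gchoose n = (-1) ^ n * (fact (n + j + 1) / (fact n * fact (j + 1)))" .
  thus ?thesis
    by (simp add: psi_coeff_def mult_ac del: fact_Suc)
qed

text \<open>
  Up to a factor that depends only on \<open>n\<close> and \<open>L\<close>, the product is the coefficient that occurs in the
  inversion of the brackets, for \<open>v = 2n + 1\<close>. This is why the constants of the theorem have their form.
\<close>

lemma psi_coeff_mult_bracket_coeff:
  assumes "N \<le> L"
  shows "psi_coeff (Suc n + N) (L - N) * bracket_coeff (Suc n + N) (Suc n)
    = (-1) ^ L * fact (2 * n + 1) * fact (L + n) * fact (L + n + 1) / (fact n * fact (n + 1))
      * (of_nat (2 * n + 1 + 2 * N) / (fact (2 * n + 1 + L + N) * fact (L - N) * of_nat (2 * n + 1 + N)))"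
proof -
  obtain d where L: "L = N + d"
    using assms le_Suc_ex by blast
  have 1: "psi_coeff (Suc n + N) (L - N) = (-1) ^ d * fact (2 * (n + N) + 1) * fact (L + n) * fact (L + n + 1)
      / (fact (2 * n + 1 + L + N) * fact (n + N) * fact (n + N + 1) * fact d)"
    using psi_coeff_Suc[of "n + N" d] by (simp add: L add_ac mult_2 del: fact_Suc)
  have "of_nat ((Suc n + N) choose N) = (fact (n + N + 1) / (fact N * fact (n + 1)) :: complex)"
    using binomial_fact[of N "Suc n + N", where 'a = complex] by (simp del: fact_Suc)
  moreover have "(-1) ^ (Suc n + N) * ((-1) ^ Suc n) = ((-1) ^ N :: complex)"
    by (simp add: power_add flip: power_mult_distrib)
  ultimately have 2: "bracket_coeff (Suc n + N) (Suc n) = (-1) ^ N * (fact (n + N) / fact (2 * (n + N)))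
       * (fact (2 * n + 1) * fact N / (fact n * of_nat (2 * n + 1 + N))) * (fact (n + N + 1) / (fact N * fact (n + 1)))"
    by (simp add: bracket_coeff_def mult_2 add_ac del: fact_Suc of_nat_add of_nat_Suc power_Suc)
  have 3: "fact (2 * (n + N) + 1) = (of_nat (2 * n + 1 + 2 * N) * fact (2 * (n + N)) :: complex)"
    using fact_Suc[of "2 * (n + N)", where 'a = complex] by (simp add: add_ac del: fact_Suc)
  have 4: "L - N = d" "(-1) ^ L = ((-1) ^ d * (-1) ^ N :: complex)"
    by (simp_all add: L power_add)
  show ?thesis
    unfolding 1 2 unfolding 3 4 by (simp add: mult_ac del: fact_Suc of_nat_add of_nat_Suc of_nat_mult add_Suc_right)
qed

context differential_algebra begin

lemma psi_nth:
  assumes "j \<ge> 1"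
  shows "psi cst D j f $$ int M = (if M < j then 0 else cst (psi_coeff j (M - j)) * (D ^^ (M - j)) f)"
  using assms by (auto simp: psi_def psi_coeff_def nat_diff_distrib)

lemma psi_0_nth: "psi cst D 0 f $$ int M = (if M = 0 then f else 0)"
  by (simp add: psi_def)

lemma psi_nth_self: "psi cst D j f $$ int j = f"
  using psi_0_nth[of f 0] by (cases "j = 0") (simp_all add: psi_nth)

lemma psi_zero: "psi cst D j 0 $$ int M = 0"
  by (cases "j = 0") (simp_all add: psi_0_nth psi_nth)

lemma psi_sum:
  "psi cst D j (\<Sum>x\<in>S. h x) $$ int M = (\<Sum>x\<in>S. psi cst D j (h x) $$ int M)"
  by (cases "j = 0") (simp_all add: psi_0_nth psi_nth Dpow_sum sum_distrib_left)

text \<open>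
  At \<open>x\<^sup>M\<close> with \<open>M = n + L\<close>, this is \<open>mult_Dpow_rankin_cohen\<close>, applied with \<open>v = 2n - 1\<close> and
  multiplied by a constant.
\<close>

lemma mult_psi_nth:
  assumes "n \<ge> 1" and "n \<le> M"
  shows "a * psi cst D n g $$ int M
    = (\<Sum>m=n..M. psi cst D m (cst (bracket_coeff m n) * rankin_cohen cst D 0 (2 * int n) (m - n) a g) $$ int M)"
proof -
  obtain n' where n: "n = Suc n'"
    using assms by (cases n) auto
  obtain L where M: "M = n + L"
    using assms le_Suc_ex by blast
  define v where "v = 2 * n' + 1"
  \<comment> \<open>The factor of \<open>psi_coeff_mult_bracket_coeff\<close> that does not depend on \<open>m\<close>.\<close>
  define w where "w = ((-1) ^ L * fact v * fact (L + n') * fact (L + n' + 1) / (fact n' * fact (n' + 1)) :: complex)"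
  define K where "K N = (of_nat (v + 2 * N) / (fact (v + L + N) * fact (L - N) * of_nat (v + N)) :: complex)" for N
  have weight: "2 * int n = 1 + int v"
    by (simp add: n v_def)
  have summand: "psi cst D m (cst (bracket_coeff m n) * rankin_cohen cst D 0 (2 * int n) (m - n) a g) $$ int M
      = cst (w * K N) * (D ^^ (L - N)) (rankin_cohen cst D 0 (1 + int v) N a g)"
    if m: "m = n + N" and "N \<le> L" for m N
  proof -
    have "psi_coeff m (M - m) * bracket_coeff m n = w * K N"
      using psi_coeff_mult_bracket_coeff[OF \<open>N \<le> L\<close>, of n']
      by (simp add: M m n w_def K_def v_def del: fact_Suc)
    moreover have "psi cst D m h $$ int M = cst (psi_coeff m (M - m)) * (D ^^ (L - N)) h" for h
      using that assms psi_nth[of m h M] by (simp add: M)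
    moreover have "m - n = N"
      using m by simp
    ultimately show ?thesis
      by (simp only: Dpow_cst_mult weight mult.assoc[symmetric] cst_mult[symmetric])
  qed
  have "(\<Sum>m=n..M. psi cst D m (cst (bracket_coeff m n) * rankin_cohen cst D 0 (2 * int n) (m - n) a g) $$ int M)
      = (\<Sum>N\<le>L. cst (w * K N) * (D ^^ (L - N)) (rankin_cohen cst D 0 (1 + int v) N a g))"
  proof -
    have "sum F {n..M} = (\<Sum>N\<le>L. F (n + N))" for F :: "nat \<Rightarrow> 'r"
      by (rule sum.reindex_bij_witness[of _ "\<lambda>N. n + N" "\<lambda>m. m - n"]) (auto simp: M)
    hence "(\<Sum>m=n..M. psi cst D m (cst (bracket_coeff m n) * rankin_cohen cst D 0 (2 * int n) (m - n) a g) $$ int M)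
        = (\<Sum>N\<le>L. psi cst D (n + N) (cst (bracket_coeff (n + N) n) * rankin_cohen cst D 0 (2 * int n) (n + N - n) a g) $$ int M)" .
    also have "\<dots> = (\<Sum>N\<le>L. cst (w * K N) * (D ^^ (L - N)) (rankin_cohen cst D 0 (1 + int v) N a g))"
      by (intro sum.cong refl summand) simp
    finally show ?thesis .
  qed
  also have "\<dots> = cst w * (\<Sum>N\<le>L. cst (K N) * (D ^^ (L - N)) (rankin_cohen cst D 0 (1 + int v) N a g))"
    by (simp add: cst_mult mult.assoc sum_distrib_left)
  also have "\<dots> = cst w * (cst (1 / (fact (v + L) * fact L)) * (a * (D ^^ L) g))"
    unfolding K_def using mult_Dpow_rankin_cohen[of v L a g] by (simp add: v_def)
  also have "\<dots> = cst (w * (1 / (fact (v + L) * fact L))) * (a * (D ^^ L) g)"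
    by (simp only: cst_mult mult.assoc)
  also have "w * (1 / (fact (v + L) * fact L)) = psi_coeff n L"
    by (simp add: n psi_coeff_Suc w_def v_def add_ac del: fact_Suc)
  also have "cst (psi_coeff n L) * (a * (D ^^ L) g) = a * psi cst D n g $$ int M"
    using assms psi_nth[of n g M] by (simp add: M mult.left_commute)
  finally show ?thesis ..
qed

end

section \<open>Recovering the components of a series\<close>

lemma formal_sum_nth: "formal_sum p $$ int M = (\<Sum>k\<le>M. p k $$ int M)"
  by (simp add: formal_sum_def)

lemma Psi2_nth: "Psi2 cst D f $$ int M = (\<Sum>j\<le>M. psi cst D j (f j) $$ int M)"
  by (simp add: Psi2_def formal_sum_nth)

context differential_algebra begin

text \<open>
  The coefficients of a sum of lifts are triangular in its components, with \<open>1\<close> on the diagonal. The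
  bound \<open>N\<close> allows the conclusion that a series without terms below \<open>x\<^sup>N\<close> has no components below
  weight \<open>2N\<close>.
\<close>

lemma Psi2_nth_determines:
  assumes "\<And>M. M < N \<Longrightarrow> Psi2 cst D f $$ int M = Psi2 cst D h $$ int M" and "M < N"
  shows "f M = h M"
  using \<open>M < N\<close>
proof (induction M rule: less_induct)
  case (less M)
  have "Psi2 cst D f' $$ int M = (\<Sum>j<M. psi cst D j (f' j) $$ int M) + f' M" for f'
    by (simp add: Psi2_nth psi_nth_self flip: lessThan_Suc_atMost)
  moreover have "(\<Sum>j<M. psi cst D j (f j) $$ int M) = (\<Sum>j<M. psi cst D j (h j) $$ int M)"
    using less by simp
  ultimately show ?case
    using assms(1)[OF less.prems] by simp
qed

lemma minus_Dpow_0 [simp]: "((\<lambda>f. - D f) ^^ n) 0 = 0"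
  by (induction n) simp_all

text \<open>
  The factor on the left is not moved past \<open>x\<close>. In the formula for the product this shows in the
  binomial coefficient of \<open>m - k - 1\<close> over \<open>m - k\<close>, which is \<open>0\<close> for \<open>k < m\<close>.
\<close>

lemma skew_times_const_nth: "skew_times cst D (fls_const a) q $$ m = a * q $$ m"
proof -
  define T where "T k = a * cst (of_int (m - k - 1) gchoose nat (m - k)) * ((\<lambda>f. - D f) ^^ nat (m - k)) (q $$ k)" for k
  have vanish: "T k = 0" if "k < m" for k
  proof -
    have "(of_int (m - k - 1) :: complex) = of_nat (nat (m - k) - 1)"
      using that by (simp add: of_nat_diff)
    hence "(of_int (m - k - 1) :: complex) gchoose nat (m - k) = of_nat ((nat (m - k) - 1) choose nat (m - k))"
      by (simp only: binomial_gbinomial)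
    also have "\<dots> = 0"
      using that by (simp add: binomial_eq_0)
    finally show ?thesis by (simp add: T_def)
  qed
  have "skew_times cst D (fls_const a) q $$ m
      = (\<Sum>i=0..m - fls_subdegree q. if i = 0 then (\<Sum>k=fls_subdegree q..m. T k) else 0)"
    unfolding skew_times_nth by (intro sum.cong) (auto simp: T_def)
  also have "\<dots> = (\<Sum>k=fls_subdegree q..m. T k)"
    by simp
  also have "\<dots> = (\<Sum>k=fls_subdegree q..m. if k = m then T m else 0)"
    using vanish by (intro sum.cong) auto
  also have "\<dots> = a * q $$ m"
    by (auto simp: T_def)
  finally show ?thesis .
qed

lemma skew_times_nth_eq_0:
  assumes "\<And>i. i < s \<Longrightarrow> p $$ i = 0" and "\<And>k. k < t \<Longrightarrow> q $$ k = 0" and "m < s + t"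
  shows "skew_times cst D p q $$ m = 0"
  unfolding skew_times_nth
proof (intro sum.neutral ballI)
  fix i k
  assume k: "k \<in> {fls_subdegree q..m - i}"
  have "i < s \<or> k < t"
    using k \<open>m < s + t\<close> by auto
  thus "p $$ i * cst (of_int (m - k - 1) gchoose nat (m - i - k))
         * ((\<lambda>f. - D f) ^^ nat (m - i - k)) (q $$ k) = 0"
    using assms by auto
qed

lemma skew_power_nth_eq_0:
  assumes "\<And>i. i < 1 \<Longrightarrow> u $$ i = 0" and "m < int n"
  shows "skew_power cst D u n $$ m = 0"
  using \<open>m < int n\<close>
proof (induction n arbitrary: m)
  case 0
  thus ?case by simp
next
  case (Suc n)
  show ?case
    unfolding skew_power.simps by (rule skew_times_nth_eq_0[where s = 1 and t = "int n"]) (use assms Suc in auto)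
qed

lemma rankin_cohen_0_right: "rankin_cohen cst D k l n f 0 = 0"
  by (simp add: rankin_cohen_def)

text \<open>
  As \<open>u\<close> has only positive powers of \<open>x\<close>, the power \<open>u\<^sup>k\<close> is divisible by \<open>x\<^sup>k\<close>, so that its components of
  weight below \<open>2k\<close> vanish; hence only the terms with \<open>k \<le> n \<le> m\<close> occur.
\<close>

theorem Psi2_inverse_formula:
  assumes u: "\<And>i. i < 1 \<Longrightarrow> u $$ i = 0"
    and g: "\<And>k. Psi2 cst D (g k) = skew_power cst D u k"
    and f: "Psi2 cst D f = formal_sum (\<lambda>k. skew_times cst D (fls_const (a k)) (skew_power cst D u k))"
  shows "f 0 = a 0"
    and "m \<ge> 1 \<Longrightarrow> f m = (\<Sum>k=0..m. \<Sum>n=max k 1..m.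
            cst (bracket_coeff m n) * rankin_cohen cst D 0 (2 * int n) (m - n) (a k) (g k n))"
proof -
  have Psi2_0: "Psi2 cst D (\<lambda>j. 0) $$ int M = 0" for M
    by (simp add: Psi2_nth psi_zero)
  have g_low: "g k n = 0" if "n < k" for k n
    by (rule Psi2_nth_determines[of k "g k" "\<lambda>j. 0"]) (use that in \<open>simp_all add: Psi2_0 g skew_power_nth_eq_0[OF u]\<close>)
  have g_0: "g 0 n = (if n = 0 then 1 else 0)" for n
  proof (rule Psi2_nth_determines[of "Suc n" "g 0" "\<lambda>n. if n = 0 then 1 else 0"])
    fix M
    have "psi cst D j (if j = 0 then 1 else 0) $$ int M = (if j = 0 then if M = 0 then 1 else 0 else 0)" for j
      by (simp add: psi_0_nth psi_zero)
    hence "Psi2 cst D (\<lambda>n. if n = 0 then 1 else 0) $$ int M = (\<Sum>j\<le>M. if j = 0 then if M = 0 then 1 else 0 else 0)"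
      by (simp only: Psi2_nth)
    thus "Psi2 cst D (g 0) $$ int M = Psi2 cst D (\<lambda>n. if n = 0 then 1 else 0) $$ int M"
      by (simp add: g)
  qed simp
  define c where "c m n k = cst (bracket_coeff m n) * rankin_cohen cst D 0 (2 * int n) (m - n) (a k) (g k n)" for m n k
  define h where "h m = (if m = 0 then a 0 else \<Sum>k=0..m. \<Sum>n=max k 1..m. c m n k)" for m
  have c_low: "c m n k = 0" if "n < k" for m n k
    using that by (simp add: c_def g_low rankin_cohen_0_right)
  \<comment> \<open>Ranges that do not link \<open>n\<close> with \<open>k\<close>, nor \<open>k\<close> with \<open>m\<close>, so that sums can be interchanged.\<close>
  have h_extend: "h m = (\<Sum>k\<le>M. \<Sum>n=1..m. c m n k)" if "1 \<le> m" "m \<le> M" for m M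
  proof -
    have "(\<Sum>n=max k 1..m. c m n k) = (\<Sum>n=1..m. c m n k)" for k
      by (rule sum.mono_neutral_left) (auto intro: c_low)
    hence "h m = (\<Sum>k=0..m. \<Sum>n=1..m. c m n k)"
      using that by (simp add: h_def)
    also have "\<dots> = (\<Sum>k\<le>M. \<Sum>n=1..m. c m n k)"
      using that by (intro sum.mono_neutral_left) (auto intro!: sum.neutral c_low)
    finally show ?thesis .
  qed
  have "Psi2 cst D f $$ int M = Psi2 cst D h $$ int M" for M
  proof (cases "M = 0")
    case True
    thus ?thesis
      using f by (simp add: formal_sum_nth[of _ 0, simplified] Psi2_nth[of _ _ _ 0, simplified] skew_times_const_nth psi_0_nth[of _ 0, simplified] h_def)
  next
    case False
    have coeff: "a k * skew_power cst D u k $$ int M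
        = (\<Sum>m=1..M. psi cst D m (\<Sum>n=1..m. c m n k) $$ int M)" for k
    proof -
      have "a k * skew_power cst D u k $$ int M = (\<Sum>n\<le>M. a k * psi cst D n (g k n) $$ int M)"
        by (simp add: Psi2_nth sum_distrib_left flip: g)
      also have "\<dots> = (\<Sum>n=1..M. a k * psi cst D n (g k n) $$ int M)"
        using False by (intro sum.mono_neutral_right) (auto simp: psi_0_nth not_less_eq_eq)
      also have "\<dots> = (\<Sum>n=1..M. \<Sum>m=n..M. psi cst D m (c m n k) $$ int M)"
        by (intro sum.cong refl) (simp add: mult_psi_nth c_def)
      also have "\<dots> = (\<Sum>m=1..M. \<Sum>n=1..m. psi cst D m (c m n k) $$ int M)"
        unfolding sum.Sigma[OF finite_atLeastAtMost ballI[OF finite_atLeastAtMost]]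
        by (rule sum.reindex_bij_witness[of _ prod.swap prod.swap]) auto
      finally show ?thesis by (simp add: psi_sum)
    qed
    have "Psi2 cst D f $$ int M = (\<Sum>k\<le>M. \<Sum>m=1..M. psi cst D m (\<Sum>n=1..m. c m n k) $$ int M)"
      unfolding f formal_sum_nth by (simp add: skew_times_const_nth coeff)
    also have "\<dots> = (\<Sum>m=1..M. psi cst D m (h m) $$ int M)"
      by (subst sum.swap) (simp add: h_extend[where M = M] flip: psi_sum)
    also have "\<dots> = Psi2 cst D h $$ int M"
      unfolding Psi2_nth using False by (intro sum.mono_neutral_left) (auto simp: psi_0_nth not_less_eq_eq)
    finally show ?thesis .
  qed
  hence eq: "f m = h m" for m
    by (rule Psi2_nth_determines[of "Suc m" f h]) simp_all
  show "f 0 = a 0"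
    by (simp add: eq h_def)
  show "m \<ge> 1 \<Longrightarrow> f m = (\<Sum>k=0..m. \<Sum>n=max k 1..m.
            cst (bracket_coeff m n) * rankin_cohen cst D 0 (2 * int n) (m - n) (a k) (g k n))"
    by (simp add: eq h_def c_def)
qed

end

section \<open>Algebras of functions as differential algebras\<close>

context modular_function_algebra begin

lemma eventually_analytic: "\<forall>\<^sub>\<approx>z\<in>\<Omega>. ev f analytic_on {z}"
  by (rule meromorphic_on_imp_analytic_cosparse) (rule ev_meromorphic)

text \<open>
  Two functions that agree off a discrete closed set agree near every other point of \<open>\<Omega>\<close>.
\<close>

lemma eventually_deriv_cong:
  assumes "\<forall>\<^sub>\<approx>z\<in>\<Omega>. F z = G z"
  shows "\<forall>\<^sub>\<approx>z\<in>\<Omega>. deriv F z = deriv G z"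
  unfolding eventually_cosparse_open_eq[OF open_domain]
proof
  fix x assume "x \<in> \<Omega>"
  hence "\<forall>\<^sub>F z in at x. F z = G z"
    using assms eventually_cosparse_open_eq[OF open_domain] by blast
  then obtain S where S: "open S" "x \<in> S" "\<And>z. z \<in> S \<Longrightarrow> z \<noteq> x \<Longrightarrow> F z = G z"
    by (auto simp: eventually_at_topological)
  have "deriv F z = deriv G z" if "z \<in> S" "z \<noteq> x" for z
  proof (rule deriv_cong_ev[OF _ refl])
    have "open (S - {x})"
      using S by blast
    thus "\<forall>\<^sub>F w in nhds z. F w = G w"
      unfolding eventually_nhds using S that by (intro exI[of _ "S - {x}"]) auto
  qed
  thus "\<forall>\<^sub>F z in at x. deriv F z = deriv G z"
    unfolding eventually_at_topological using S by blast
qed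

text \<open>
  The rules of differentiation hold in the algebra because they hold for the functions at the points
  where these are analytic, and an element of the algebra is determined by almost all of its values.
\<close>

sublocale differential_algebra cst D
proof
  show "cst 1 = 1"
  proof -
    have "cst 1 * cst 1 = cst 1"
      by (rule ev_inject) (use ev_mult[of "cst 1" "cst 1"] ev_cst[of 1] in \<open>eventually_elim, simp\<close>)
    moreover have "cst 1 * 1 = 1"
      by (rule ev_inject) (use ev_mult[of "cst 1" 1] ev_cst[of 1] in \<open>eventually_elim, simp\<close>)
    ultimately show ?thesis by simp
  qed
  show "cst (a + b) = cst a + cst b" for a b
    by (rule ev_inject) (use ev_add[of "cst a" "cst b"] ev_cst[of a] ev_cst[of b] ev_cst[of "a + b"] in \<open>eventually_elim, simp\<close>)
  show "cst (a * b) = cst a * cst b" for a b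
    by (rule ev_inject) (use ev_mult[of "cst a" "cst b"] ev_cst[of a] ev_cst[of b] ev_cst[of "a * b"] in \<open>eventually_elim, simp\<close>)
  show "D (f + g) = D f + D g" for f g
    by (rule ev_inject)
       (use ev_add[of "D f" "D g"] ev_D[of f] ev_D[of g] ev_D[of "f + g"] eventually_deriv_cong[OF ev_add[of f g]]
            eventually_analytic[of f] eventually_analytic[of g]
          in \<open>eventually_elim, simp add: analytic_on_imp_differentiable_at\<close>)
  show "D (f * g) = f * D g + D f * g" for f g
    by (rule ev_inject)
       (use ev_add[of "f * D g" "D f * g"] ev_mult[of f "D g"] ev_mult[of "D f" g] ev_D[of f] ev_D[of g] ev_D[of "f * g"]
            eventually_deriv_cong[OF ev_mult[of f g]] eventually_analytic[of f] eventually_analytic[of g]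
          in \<open>eventually_elim, simp add: analytic_on_imp_differentiable_at\<close>)
  show "D (cst c) = 0" for c
    by (rule ev_inject)
       (use ev_D[of "cst c"] eventually_deriv_cong[OF ev_cst[of c]] ev_add[of 0 0]
          in \<open>eventually_elim, simp\<close>)
qed

end

section \<open>The components of an invariant series\<close>

theorem proposition2p4p4:
  fixes \<Omega> :: "complex set"
    and \<Gamma> :: "(complex^2^2) set"
    and ev :: "'r::idom \<Rightarrow> complex \<Rightarrow> complex"
    and cst :: "complex \<Rightarrow> 'r"
    and D :: "'r \<Rightarrow> 'r"
    and act :: "complex^2^2 \<Rightarrow> 'r \<Rightarrow> 'r"
    and J :: "complex^2^2 \<Rightarrow> 'r"
    and chi :: 'r
    and u q :: "'r fls"
    and a f :: "nat \<Rightarrow> 'r"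
    and g :: "nat \<Rightarrow> nat \<Rightarrow> 'r"
  assumes "modular_function_algebra \<Omega> \<Gamma> ev cst D act J"
    and "chi \<in> modular_forms \<Gamma> act J 2" and "chi dvd 1"
    and "u = skew_times cst D fls_X (fls_const chi)"
    and "\<And>k n. g k n \<in> modular_forms \<Gamma> act J (2 * int n)"
    and "\<And>k. Psi2 cst D (g k) = skew_power cst D u k"
    and "q \<in> invariant_series \<Gamma> cst D act J"
    and "\<And>k. a k \<in> modular_forms \<Gamma> act J 0"
    and "q = formal_sum (\<lambda>k. skew_times cst D (fls_const (a k)) (skew_power cst D u k))"
    and "\<And>m. f m \<in> modular_forms \<Gamma> act J (2 * int m)"
    and "Psi2 cst D f = q"
  shows "f 0 = a 0 \<and>
    (\<forall>m\<ge>1. f m =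
       cst ((-1) ^ m * (fact (m - 1) / fact (2 * m - 2)))
       * (\<Sum>k=0..m. \<Sum>n=max k 1..m.
            cst ((-1) ^ n * (fact (2 * n - 1) * fact (m - n) / (fact (n - 1) * of_nat (m + n - 1)))
                 * of_nat (m choose (m - n)))
            * rankin_cohen cst D 0 (2 * int n) (m - n) (a k) (g k n)))"
proof -
  interpret modular_function_algebra \<Omega> \<Gamma> ev cst D act J
    by (rule assms(1))
  have u: "u $$ i = 0" if "i < 1" for i
    unfolding assms(4) using that by (intro skew_times_nth_eq_0[where s = 1 and t = 0]) auto
  have f: "Psi2 cst D f = formal_sum (\<lambda>k. skew_times cst D (fls_const (a k)) (skew_power cst D u k))"
    using assms(9,11) by simp
  have components: "f m = (\<Sum>k=0..m. \<Sum>n=max k 1..m.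
      cst (bracket_coeff m n) * rankin_cohen cst D 0 (2 * int n) (m - n) (a k) (g k n))" if "m \<ge> 1" for m
    by (rule Psi2_inverse_formula(2)[OF _ assms(6) f that]) (rule u)
  have "f m = cst ((-1) ^ m * (fact (m - 1) / fact (2 * m - 2)))
       * (\<Sum>k=0..m. \<Sum>n=max k 1..m.
            cst ((-1) ^ n * (fact (2 * n - 1) * fact (m - n) / (fact (n - 1) * of_nat (m + n - 1)))
                 * of_nat (m choose (m - n)))
            * rankin_cohen cst D 0 (2 * int n) (m - n) (a k) (g k n))" if "m \<ge> 1" for m
    unfolding components[OF that] sum_distrib_left
    by (intro sum.cong refl) (simp only: bracket_coeff_def cst_mult mult.assoc)
  moreover have "f 0 = a 0"
    by (rule Psi2_inverse_formula(1)[OF _ assms(6) f]) (rule u)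
  ultimately show ?thesis by blast
qed

end
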